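(* Let $x\in\mathbb{B}^n$ and $r>0$. Then $B_h(x,l_0)\subseteq B_\rho(x,r)\subseteq B_h(x,l_1)\subsetneq\mathbb{B}^n$ holds if and only if $$l_0\le 2\,\operatorname{arsinh}\left(\sqrt{1-|x|^2}\,\sinh(r/2)\right)\quad\text{and}\quad l_1\ge r.$$
   Context: Let $n\ge 2$ and let $\mathbb{B}^n$ be the open Euclidean unit ball in $\mathbb{R}^n$, with boundary sphere $S^{n-1}$. For distinct $x,y\in\mathbb{R}^n$, $L(x,y)$ denotes the Euclidean line through $x$ and $y$. $\operatorname{arsinh}$ is the inverse of $\sinh$. Hilbert metric: for distinct $x,y\in\mathbb{B}^n$, $$h_{\mathbb{B}^n}(x,y)=\log\frac{|u-y|\,|x-v|}{|u-x|\,|y-v|},$$ where $u,v$ are the two points of $L(x,y)\cap S^{n-1}$, ordered so that $|u-x|<|u-y|$; and $h_{\mathbb{B}^n}(x,x)=0$. The logarithm is natural. Hyperbolic metric: $\rho_{\mathbb{B}^n}(x,y)\ge 0$ is defined by $$\sinh^2\frac{\rho_{\mathbb{B}^n}(x,y)}{2}=\frac{|x-y|^2}{(1-|x|^2)(1-|y|^2)},\qquad x,y\in\mathbb{B}^n.$$ Balls: $B_h(x,l)=\{y\in\mathbb{B}^n: h_{\mathbb{B}^n}(x,y)<l\}$ and $B_\rho(x,r)=\{y\in\mathbb{B}^n:\rho_{\mathbb{B}^n}(x,y)<r\}$; $l_0,l_1$ are real radii. *)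

theory Defs
  imports "HOL-Analysis.Analysis"
begin

text \<open>
  The line through two distinct points is their affine hull. Since \<open>x\<close> and \<open>y\<close> lie in
  the open unit ball, the line meets the unit sphere in exactly two points, and the condition
  \<open>norm (u - x) < norm (u - y)\<close> determines which of them is \<open>u\<close>; hence the description
  below has a unique solution. Outside the unit ball the value is not meaningful.
\<close>

definition hilbert_dist :: "real ^ 'n \<Rightarrow> real ^ 'n \<Rightarrow> real" where
  "hilbert_dist x y =
     (if x = y then 0
      else THE d. \<exists>u v. affine hull {x, y} \<inter> sphere 0 1 = {u, v} \<and>
                        norm (u - x) < norm (u - y) \<and>
                        d = ln ((norm (u - y) * norm (x - v)) / (norm (u - x) * norm (y - v))))"

definition hyperbolic_dist :: "real ^ 'n \<Rightarrow> real ^ 'n \<Rightarrow> real" where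
  "hyperbolic_dist x y =
     (THE d. d \<ge> 0 \<and>
             (sinh (d / 2))\<^sup>2 = (norm (x - y))\<^sup>2 / ((1 - (norm x)\<^sup>2) * (1 - (norm y)\<^sup>2)))"

definition hilbert_ball :: "real ^ 'n \<Rightarrow> real \<Rightarrow> (real ^ 'n) set" where
  "hilbert_ball x l = {y \<in> ball 0 1. hilbert_dist x y < l}"

definition hyperbolic_ball :: "real ^ 'n \<Rightarrow> real \<Rightarrow> (real ^ 'n) set" where
  "hyperbolic_ball x r = {y \<in> ball 0 1. hyperbolic_dist x y < r}"

end

theory Submission
  imports Defs
begin

text \<open>
  Write \<open>y = x + t e\<close> with a unit vector \<open>e\<close>. The chord of the unit ball through \<open>x\<close> in
  direction \<open>e\<close> has half-length \<open>c = sqrt (1 - |x|\<^sup>2 + (x \<bullet> e)\<^sup>2)\<close>, and the whole theorem rests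
  on the identity
  \<open>sinh (h / 2) = c * sinh (\<rho> / 2)\<close>
  between the Hilbert distance \<open>h\<close> and the hyperbolic distance \<open>\<rho>\<close> of \<open>x\<close> and \<open>y\<close>
  (lemma \<open>sinh_half_hilbert_dist\<close>). So for fixed \<open>x\<close> the comparison of the two metrics
  depends only on the direction \<open>e\<close>.

  By Cauchy-Schwarz, \<open>sqrt (1 - |x|\<^sup>2) \<le> c \<le> 1\<close>, which gives both inclusions of balls for the
  stated radii. The bounds on \<open>c\<close> are attained: the upper one when \<open>e\<close> is parallel to \<open>x\<close>
  (the chord is a diameter), the lower one when \<open>e\<close> is orthogonal to \<open>x\<close>, and such an \<open>e\<close>
  exists as the dimension is at least two. Since every positive hyperbolic distance from \<open>x\<close>
  occurs in every direction (lemma \<open>hyperbolic_dist_attained\<close>), moving in an extremal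
  direction refutes any worse radius; points at large distance on the diameter show that no
  Hilbert ball fills the unit ball.
\<close>

definition half_chord :: "'a::real_inner \<Rightarrow> 'a \<Rightarrow> real" where
  "half_chord x e = sqrt (1 - (norm x)\<^sup>2 + (x \<bullet> e)\<^sup>2)"

lemma norm_less_1_imp_square: "norm x < 1 \<Longrightarrow> 0 < 1 - (norm x)\<^sup>2"
  by (simp add: abs_square_less_1)

lemma half_chord_square:
  assumes "norm x < 1"
  shows "(half_chord x e)\<^sup>2 = 1 - (norm x)\<^sup>2 + (x \<bullet> e)\<^sup>2"
  unfolding half_chord_def using norm_less_1_imp_square[OF assms]
  by (intro real_sqrt_pow2) (simp add: add_nonneg_nonneg)

lemma half_chord_bounds:
  assumes "norm e = 1"
  shows "sqrt (1 - (norm x)\<^sup>2) \<le> half_chord x e" "half_chord x e \<le> 1"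
proof -
  have "(x \<bullet> e)\<^sup>2 \<le> (norm x)\<^sup>2"
    using Cauchy_Schwarz_ineq2[of x e] assms by (metis abs_le_square_iff abs_norm_cancel mult.right_neutral)
  then show "sqrt (1 - (norm x)\<^sup>2) \<le> half_chord x e" "half_chord x e \<le> 1"
    by (auto simp: half_chord_def)
qed

lemma norm_along_line_square:
  fixes x e :: "'a::real_inner"
  assumes "norm e = 1"
  shows "(norm (x + s *\<^sub>R e))\<^sup>2 = (norm x)\<^sup>2 + 2 * s * (x \<bullet> e) + s\<^sup>2"
proof -
  have "e \<bullet> e = 1" using assms by (simp add: norm_eq_1)
  then show ?thesis
    unfolding power2_norm_eq_inner
    by (simp add: inner_add_left inner_add_right inner_commute power2_eq_square algebra_simps)
qed

text \<open>
  The endpoints of the chord through \<open>x\<close> in direction \<open>e\<close> are the points \<open>x + s e\<close> with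
  \<open>s = a\<close> and \<open>s = b\<close>, the roots of the quadratic \<open>1 - |x + s e|\<^sup>2\<close>. Its factored form replaces
  all explicit computation with these roots.
\<close>
lemma chord_endpoints:
  fixes x e :: "'a::real_inner"
  assumes "norm e = 1" "norm x < 1" "norm (x + t *\<^sub>R e) < 1" "0 \<le> t"
  obtains a b where "a < 0" "t < b" "b - a = 2 * half_chord x e"
    "\<And>s. 1 - (norm (x + s *\<^sub>R e))\<^sup>2 = (s - a) * (b - s)"
proof
  let ?c = "half_chord x e" and ?p = "x \<bullet> e"
  have c2: "?c\<^sup>2 = 1 - (norm x)\<^sup>2 + ?p\<^sup>2"
    by (rule half_chord_square[OF assms(2)])
  show fac: "1 - (norm (x + s *\<^sub>R e))\<^sup>2 = (s - (- ?p - ?c)) * ((- ?p + ?c) - s)" for s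
  proof -
    have "(s - (- ?p - ?c)) * ((- ?p + ?c) - s) = ?c\<^sup>2 - (s + ?p)\<^sup>2"
      by (simp add: power2_eq_square algebra_simps)
    then show ?thesis
      unfolding norm_along_line_square[OF assms(1)] c2
      by (simp add: power2_eq_square algebra_simps)
  qed
  have "(- ?p)\<^sup>2 < 1 - (norm x)\<^sup>2 + ?p\<^sup>2"
    using norm_less_1_imp_square[OF assms(2)] by simp
  then show "- ?p - ?c < 0"
    unfolding half_chord_def using real_less_rsqrt by fastforce
  have "(t + ?p)\<^sup>2 < 1 - (norm x)\<^sup>2 + ?p\<^sup>2"
    using norm_less_1_imp_square[OF assms(3)] norm_along_line_square[OF assms(1), of x t]
    by (simp add: power2_eq_square algebra_simps)
  then show "t < - ?p + ?c"
    unfolding half_chord_def using real_less_rsqrt by fastforce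
qed simp

lemma sinh_half_ln_square:
  assumes "0 < (C::real)"
  shows "(sinh (ln C / 2))\<^sup>2 = (C - 1)\<^sup>2 / (4 * C)"
proof -
  have "cosh (2 * (ln C / 2)) = 2 * (sinh (ln C / 2))\<^sup>2 + 1"
    by (subst cosh_double) (simp add: cosh_square_eq)
  then have "(sinh (ln C / 2))\<^sup>2 = (cosh (ln C) - 1) / 2" by simp
  also have "\<dots> = (C - 1)\<^sup>2 / (4 * C)"
    using assms by (simp add: cosh_ln_real field_simps power2_eq_square)
  finally show ?thesis .
qed

text \<open>
  The defining description of \<open>hyperbolic_dist\<close> is satisfiable by a unique number because
  \<open>sinh\<close> is a bijection of the nonnegative reals.
\<close>
lemma hyperbolic_dist_spec:
  fixes x y :: "real ^ 'n"
  assumes "norm x < 1" "norm y < 1"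
  shows "0 \<le> hyperbolic_dist x y"
    and "(sinh (hyperbolic_dist x y / 2))\<^sup>2
      = (norm (x - y))\<^sup>2 / ((1 - (norm x)\<^sup>2) * (1 - (norm y)\<^sup>2))"
proof -
  define Q where "Q = (norm (x - y))\<^sup>2 / ((1 - (norm x)\<^sup>2) * (1 - (norm y)\<^sup>2))"
  have "0 \<le> Q"
    using norm_less_1_imp_square[OF assms(1)] norm_less_1_imp_square[OF assms(2)]
    unfolding Q_def by (intro divide_nonneg_pos mult_pos_pos) auto
  let ?P = "\<lambda>d. 0 \<le> d \<and> (sinh (d / 2))\<^sup>2 = Q"
  have "\<exists>!d. ?P d"
  proof
    have "0 \<le> arsinh (sqrt Q)"
      using \<open>0 \<le> Q\<close> by (metis real_sqrt_ge_zero sinh_arsinh_real sinh_real_nonneg_iff)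
    then show "?P (2 * arsinh (sqrt Q))"
      using \<open>0 \<le> Q\<close> by simp
  next
    fix d assume d: "?P d"
    then have "sinh (d / 2) = sqrt Q"
      by (metis divide_nonneg_pos real_sqrt_unique sinh_real_nonneg_iff zero_less_numeral)
    then have "arsinh (sqrt Q) = d / 2"
      by (metis arsinh_sinh_real)
    then show "d = 2 * arsinh (sqrt Q)" by simp
  qed
  then have "?P (hyperbolic_dist x y)"
    unfolding hyperbolic_dist_def Q_def[symmetric] by (rule theI')
  then show "0 \<le> hyperbolic_dist x y"
    and "(sinh (hyperbolic_dist x y / 2))\<^sup>2
      = (norm (x - y))\<^sup>2 / ((1 - (norm x)\<^sup>2) * (1 - (norm y)\<^sup>2))"
    by (simp_all add: Q_def)
qed

text \<open>
  The condition \<open>norm (u - x) < norm (u - y)\<close> excludes the swapped labelling of the two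
  intersection points, so the description in \<open>hilbert_dist\<close> selects the cross ratio of the
  four positions \<open>a < 0 < t < b\<close> on the chord.
\<close>
lemma hilbert_dist_eq_ln_cross_ratio:
  fixes x e :: "real ^ 'n"
  assumes e: "norm e = 1" and t: "0 < t" and a: "a < 0" and b: "t < b"
    and fac: "\<And>s. 1 - (norm (x + s *\<^sub>R e))\<^sup>2 = (s - a) * (b - s)"
  shows "hilbert_dist x (x + t *\<^sub>R e) = ln (((t - a) * b) / ((- a) * (b - t)))"
proof -
  let ?y = "x + t *\<^sub>R e" and ?a = "x + a *\<^sub>R e" and ?b = "x + b *\<^sub>R e"
  have "e \<noteq> 0" using e by auto
  have line: "affine hull {x, ?y} = range (\<lambda>s. x + s *\<^sub>R e)"
  proof -
    have "x + s *\<^sub>R e \<in> range (\<lambda>u. x + (u * t) *\<^sub>R e)" for s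
      using t by (intro range_eqI[of _ _ "s / t"]) simp
    then show ?thesis
      unfolding affine_hull_2_alt by auto
  qed
  have "norm (x + s *\<^sub>R e) = 1 \<longleftrightarrow> s = a \<or> s = b" for s
  proof -
    have "norm (x + s *\<^sub>R e) = 1 \<longleftrightarrow> 1 - (norm (x + s *\<^sub>R e))\<^sup>2 = 0"
      by (simp add: abs_square_eq_1)
    then show ?thesis unfolding fac by auto
  qed
  then have inter: "affine hull {x, ?y} \<inter> sphere 0 1 = {?a, ?b}"
    unfolding line by auto
  have dst: "norm (x + s *\<^sub>R e - (x + s' *\<^sub>R e)) = \<bar>s - s'\<bar>" for s s'
    using e by (simp add: scaleR_left_diff_distrib[symmetric])
  have dst0: "norm (x + s *\<^sub>R e - x) = \<bar>s\<bar>" "norm (x - (x + s *\<^sub>R e)) = \<bar>s\<bar>" for s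
    using e by simp_all
  have "hilbert_dist x ?y = (THE d. \<exists>u v. {?a, ?b} = {u, v} \<and>
      norm (u - x) < norm (u - ?y) \<and>
      d = ln ((norm (u - ?y) * norm (x - v)) / (norm (u - x) * norm (?y - v))))"
    unfolding hilbert_dist_def inter using t \<open>e \<noteq> 0\<close> by simp
  also have "\<dots> = ln (((t - a) * b) / ((- a) * (b - t)))"
  proof (rule the_equality)
    show "\<exists>u v. {?a, ?b} = {u, v} \<and> norm (u - x) < norm (u - ?y) \<and>
      ln (((t - a) * b) / ((- a) * (b - t)))
        = ln ((norm (u - ?y) * norm (x - v)) / (norm (u - x) * norm (?y - v)))"
      by (rule exI[of _ ?a], rule exI[of _ ?b], unfold dst dst0) (use t a b in simp)
  next
    fix d
    assume "\<exists>u v. {?a, ?b} = {u, v} \<and> norm (u - x) < norm (u - ?y) \<and>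
      d = ln ((norm (u - ?y) * norm (x - v)) / (norm (u - x) * norm (?y - v)))"
    then obtain u v where uv: "{?a, ?b} = {u, v}" "norm (u - x) < norm (u - ?y)"
      and d: "d = ln ((norm (u - ?y) * norm (x - v)) / (norm (u - x) * norm (?y - v)))"
      by blast
    have "u \<noteq> ?b"
    proof
      assume "u = ?b"
      with uv(2) have "\<bar>b\<bar> < \<bar>b - t\<bar>" by (simp only: dst dst0)
      with t b show False by simp
    qed
    with uv(1) have "u = ?a" "v = ?b" by (auto simp: doubleton_eq_iff)
    then have "d = ln ((\<bar>a - t\<bar> * \<bar>b\<bar>) / (\<bar>a\<bar> * \<bar>t - b\<bar>))"
      unfolding d by (simp only: dst dst0)
    then show "d = ln (((t - a) * b) / ((- a) * (b - t)))"
      using t a b by simp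
  qed
  finally show ?thesis .
qed

text \<open>
  With \<open>C\<close> the cross ratio, \<open>4 * (sinh (h / 2))\<^sup>2 = (C - 1)\<^sup>2 / C\<close>. Here \<open>C - 1\<close> has numerator
  \<open>(b - a) * t\<close>, which is the full chord length times \<open>|x - y|\<close>, while the factors \<open>(- a) * b\<close>
  and \<open>(t - a) * (b - t)\<close> are the powers \<open>1 - |x|\<^sup>2\<close> and \<open>1 - |y|\<^sup>2\<close> of \<open>x\<close> and \<open>y\<close> with
  respect to the sphere; what remains is the hyperbolic expression times the squared
  half-chord.
\<close>
lemma sinh_half_hilbert_dist:
  fixes x e :: "real ^ 'n"
  assumes e: "norm e = 1" and x: "norm x < 1" and y: "norm (x + t *\<^sub>R e) < 1" and t: "0 \<le> t"
  shows "sinh (hilbert_dist x (x + t *\<^sub>R e) / 2)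
    = half_chord x e * sinh (hyperbolic_dist x (x + t *\<^sub>R e) / 2)"
proof (cases "t = 0")
  case True
  have "hyperbolic_dist x x = 0"
    using hyperbolic_dist_spec(2)[OF x x] by simp
  then show ?thesis using True by (simp add: hilbert_dist_def)
next
  case False
  with t have t: "0 < t" by simp
  let ?y = "x + t *\<^sub>R e" and ?c = "half_chord x e"
  obtain a b where a: "a < 0" and b: "t < b" and ba: "b - a = 2 * ?c"
    and fac: "\<And>s. 1 - (norm (x + s *\<^sub>R e))\<^sup>2 = (s - a) * (b - s)"
    using chord_endpoints[OF e x y] t by (metis less_imp_le)
  define C where "C = ((t - a) * b) / ((- a) * (b - t))"
  have h: "hilbert_dist x ?y = ln C"
    unfolding C_def by (rule hilbert_dist_eq_ln_cross_ratio[OF e t a b fac])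
  have pos: "0 < - a" "0 < b" "0 < t - a" "0 < b - t" using a b t by auto
  have C1: "C - 1 = ((b - a) * t) / ((- a) * (b - t))"
  proof -
    have "(t - a) * b - (- a) * (b - t) = (b - a) * t" by (simp add: algebra_simps)
    moreover have "(- a) * (b - t) \<noteq> 0" using pos by simp
    ultimately show ?thesis
      unfolding C_def by (metis diff_divide_distrib divide_self)
  qed
  have "1 \<le> C"
  proof -
    have "0 \<le> C - 1" unfolding C1 using pos t
      by (intro divide_nonneg_nonneg mult_nonneg_nonneg) auto
    then show ?thesis by simp
  qed
  have px: "1 - (norm x)\<^sup>2 = (- a) * b" using fac[of 0] by simp
  have sq: "(sinh (ln C / 2))\<^sup>2 = (?c * sinh (hyperbolic_dist x ?y / 2))\<^sup>2"
  proof -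
    have gen: "((A * t) / (p * q))\<^sup>2 / (4 * ((m * r) / (p * q)))
        = (A / 2)\<^sup>2 * (t\<^sup>2 / ((p * r) * (m * q)))"
      if "0 < p" "0 < q" "0 < m" "0 < r" for A p q m r :: real
      using that by (simp add: field_simps power2_eq_square)
    have "(sinh (ln C / 2))\<^sup>2 = (C - 1)\<^sup>2 / (4 * C)"
      using \<open>1 \<le> C\<close> by (intro sinh_half_ln_square) simp
    also have "\<dots> = ((b - a) / 2)\<^sup>2 * (t\<^sup>2 / (((- a) * b) * ((t - a) * (b - t))))"
      unfolding C1 unfolding C_def using pos by (intro gen)
    also have "\<dots> = ?c\<^sup>2 * (t\<^sup>2 / ((1 - (norm x)\<^sup>2) * (1 - (norm ?y)\<^sup>2)))"
      unfolding ba fac px by simp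
    also have "\<dots> = ?c\<^sup>2 * (sinh (hyperbolic_dist x ?y / 2))\<^sup>2"
      unfolding hyperbolic_dist_spec(2)[OF x y] using e by simp
    finally show ?thesis by (simp add: power_mult_distrib)
  qed
  have "0 \<le> ?c" using ba pos by simp
  then show ?thesis
    unfolding h using sq \<open>1 \<le> C\<close> hyperbolic_dist_spec(1)[OF x y]
    by (simp add: power2_eq_iff_nonneg)
qed

text \<open>
  Along the ray from \<open>x\<close> in direction \<open>e\<close>, look for a zero of
  \<open>f s = s\<^sup>2 - (sinh (d / 2))\<^sup>2 (1 - |x|\<^sup>2) (1 - |x + s e|\<^sup>2)\<close>. It is negative at \<open>0\<close> and
  nonnegative at \<open>2\<close>, where the ray has left the ball; at a zero \<open>s > 0\<close> the factor
  \<open>1 - |x + s e|\<^sup>2\<close> must be positive, so the point found is inside.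
\<close>
lemma hyperbolic_dist_attained:
  fixes x e :: "real ^ 'n"
  assumes e: "norm e = 1" and x: "norm x < 1" and d: "0 < d"
  obtains t where "0 \<le> t" "norm (x + t *\<^sub>R e) < 1" "hyperbolic_dist x (x + t *\<^sub>R e) = d"
proof -
  define k where "k = (sinh (d / 2))\<^sup>2 * (1 - (norm x)\<^sup>2)"
  define f where "f s = s\<^sup>2 - k * (1 - (norm (x + s *\<^sub>R e))\<^sup>2)" for s
  have px: "0 < 1 - (norm x)\<^sup>2" by (rule norm_less_1_imp_square[OF x])
  have sd: "0 < sinh (d / 2)" using d by simp
  have k: "0 < k" unfolding k_def using px sd by simp
  have f0: "f 0 < 0" unfolding f_def using k px by simp
  have "1 \<le> norm (x + 2 *\<^sub>R e)"
    using norm_diff_ineq[of "2 *\<^sub>R e" x] e x by (simp add: add.commute)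
  then have "1 - (norm (x + 2 *\<^sub>R e))\<^sup>2 \<le> 0" by simp
  then have f2: "0 \<le> f 2"
    unfolding f_def using k by (simp add: mult_nonneg_nonpos order_trans[of _ 0])
  have "\<exists>s\<ge>0. s \<le> 2 \<and> f s = 0"
    using f0 f2 unfolding f_def by (intro IVT') (auto intro!: continuous_intros)
  then obtain s where s: "0 \<le> s" "f s = 0" by blast
  with f0 have "0 < s" by (cases "s = 0") auto
  let ?y = "x + s *\<^sub>R e"
  have eq: "s\<^sup>2 = k * (1 - (norm ?y)\<^sup>2)" using s(2) by (simp add: f_def)
  with \<open>0 < s\<close> k have py: "0 < 1 - (norm ?y)\<^sup>2"
    by (metis zero_less_mult_pos zero_less_power)
  then have y: "norm ?y < 1" by (simp add: abs_square_less_1)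
  have "(sinh (hyperbolic_dist x ?y / 2))\<^sup>2 = s\<^sup>2 / ((1 - (norm x)\<^sup>2) * (1 - (norm ?y)\<^sup>2))"
    unfolding hyperbolic_dist_spec(2)[OF x y] using e by simp
  also have "\<dots> = (sinh (d / 2))\<^sup>2"
    unfolding eq k_def using px py by simp
  finally have "sinh (hyperbolic_dist x ?y / 2) = sinh (d / 2)"
    using sd hyperbolic_dist_spec(1)[OF x y] by (simp add: power2_eq_iff_nonneg)
  then have "hyperbolic_dist x ?y = d" by simp
  with s(1) y show ?thesis by (rule that)
qed

lemma unit_vector_towards:
  fixes x y :: "'a::{real_normed_vector, perfect_space}"
  obtains e t where "norm e = 1" "0 \<le> t" "y = x + t *\<^sub>R e"
proof (cases "x = y")
  case True
  obtain e :: 'a where "norm e = 1" using vector_choose_size[of 1] by auto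
  with True show ?thesis by (intro that[of e 0]) auto
next
  case False
  then show ?thesis
    by (intro that[of "(y - x) /\<^sub>R norm (y - x)" "norm (y - x)"]) auto
qed

lemma unit_vector_along_diameter:
  fixes x :: "'a::euclidean_space"
  obtains e where "norm e = 1" "half_chord x e = 1"
proof -
  obtain e t where e: "norm e = 1" and x: "x = 0 + t *\<^sub>R e"
    using unit_vector_towards[of x 0] by metis
  have "e \<bullet> e = 1" using e by (simp add: norm_eq_1)
  then have "half_chord x e = 1"
    using e x by (simp add: half_chord_def)
  with e show ?thesis by (rule that)
qed

lemma unit_vector_shortest_chord:
  fixes x :: "'a::euclidean_space"
  assumes "2 \<le> DIM('a)"
  obtains e where "norm e = 1" "half_chord x e = sqrt (1 - (norm x)\<^sup>2)"
proof -
  obtain z where "z \<noteq> 0" "orthogonal x z"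
    using orthogonal_to_vector_exists[OF assms] by blast
  then show ?thesis
    by (intro that[of "z /\<^sub>R norm z"]) (auto simp: half_chord_def orthogonal_def)
qed

text \<open>The two bounds for the length of a chord through \<open>x\<close>, read as bounds for \<open>h\<close>.\<close>
lemma hilbert_dist_bounds:
  fixes x y :: "real ^ 'n"
  assumes x: "norm x < 1" and y: "norm y < 1"
  shows "hilbert_dist x y \<le> hyperbolic_dist x y"
    and "sqrt (1 - (norm x)\<^sup>2) * sinh (hyperbolic_dist x y / 2) \<le> sinh (hilbert_dist x y / 2)"
proof -
  obtain e t where e: "norm e = 1" and t: "0 \<le> t" and yt: "y = x + t *\<^sub>R e"
    using unit_vector_towards[of y x] by metis
  have eq: "sinh (hilbert_dist x y / 2) = half_chord x e * sinh (hyperbolic_dist x y / 2)"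
    using sinh_half_hilbert_dist[OF e x _ t] y yt by simp
  have pos: "0 \<le> sinh (hyperbolic_dist x y / 2)"
    using hyperbolic_dist_spec(1)[OF x y] by simp
  have "sinh (hilbert_dist x y / 2) \<le> sinh (hyperbolic_dist x y / 2)"
    unfolding eq using half_chord_bounds(2)[OF e, of x] pos
    by (simp add: mult_le_cancel_right2)
  then show "hilbert_dist x y \<le> hyperbolic_dist x y" by simp
  show "sqrt (1 - (norm x)\<^sup>2) * sinh (hyperbolic_dist x y / 2) \<le> sinh (hilbert_dist x y / 2)"
    unfolding eq using half_chord_bounds(1)[OF e, of x] pos by (rule mult_right_mono)
qed

lemma dists_agree_on_diameter:
  fixes x :: "real ^ 'n"
  assumes x: "norm x < 1" and d: "0 < d"
  obtains y where "norm y < 1" "hilbert_dist x y = d" "hyperbolic_dist x y = d"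
proof -
  obtain e where e: "norm e = 1" and c: "half_chord x e = 1"
    by (rule unit_vector_along_diameter)
  obtain t where t: "0 \<le> t" and y: "norm (x + t *\<^sub>R e) < 1"
    and hyp: "hyperbolic_dist x (x + t *\<^sub>R e) = d"
    by (rule hyperbolic_dist_attained[OF e x d])
  have "hilbert_dist x (x + t *\<^sub>R e) = d"
    using sinh_half_hilbert_dist[OF e x y t] c hyp by simp
  with y hyp show ?thesis by (intro that)
qed

theorem lemma5p4:
  fixes x :: "real ^ 'n" and r l0 l1 :: real
  assumes "CARD('n) \<ge> 2"
    and "x \<in> ball 0 1"
    and "r > 0"
  shows "(hilbert_ball x l0 \<subseteq> hyperbolic_ball x r \<and>
          hyperbolic_ball x r \<subseteq> hilbert_ball x l1 \<and>
          hilbert_ball x l1 \<subset> ball 0 1) \<longleftrightarrow>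
         (l0 \<le> 2 * arsinh (sqrt (1 - (norm x)\<^sup>2) * sinh (r / 2)) \<and> l1 \<ge> r)"
proof -
  let ?s = "sqrt (1 - (norm x)\<^sup>2)"
  let ?R = "2 * arsinh (?s * sinh (r / 2))"
  have x: "norm x < 1" using assms(2) by simp
  have s: "0 < ?s" using norm_less_1_imp_square[OF x] by simp
  have sR: "sinh (?R / 2) = ?s * sinh (r / 2)" by simp
  have inner: "hilbert_ball x l0 \<subseteq> hyperbolic_ball x r \<longleftrightarrow> l0 \<le> ?R"
  proof
    assume sub: "hilbert_ball x l0 \<subseteq> hyperbolic_ball x r"
    obtain e :: "real ^ 'n" where e: "norm e = 1" and c: "half_chord x e = ?s"
      using unit_vector_shortest_chord[of x] assms(1) by auto
    obtain t where t: "0 \<le> t" and y: "norm (x + t *\<^sub>R e) < 1"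
      and hyp: "hyperbolic_dist x (x + t *\<^sub>R e) = r"
      by (rule hyperbolic_dist_attained[OF e x assms(3)])
    have "sinh (hilbert_dist x (x + t *\<^sub>R e) / 2) = sinh (?R / 2)"
      using sinh_half_hilbert_dist[OF e x y t] c hyp sR by simp
    then have "hilbert_dist x (x + t *\<^sub>R e) = ?R" unfolding sinh_real_eq_iff by simp
    moreover have "x + t *\<^sub>R e \<notin> hilbert_ball x l0"
      using sub hyp by (auto simp: hyperbolic_ball_def)
    ultimately show "l0 \<le> ?R" using y by (simp add: hilbert_ball_def)
  next
    assume l0: "l0 \<le> ?R"
    show "hilbert_ball x l0 \<subseteq> hyperbolic_ball x r"
    proof
      fix y assume "y \<in> hilbert_ball x l0"
      then have y: "norm y < 1" and h: "hilbert_dist x y < l0" by (auto simp: hilbert_ball_def)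
      have "?s * sinh (hyperbolic_dist x y / 2) \<le> sinh (hilbert_dist x y / 2)"
        by (rule hilbert_dist_bounds(2)[OF x y])
      also have "\<dots> < sinh (?R / 2)"
        unfolding sinh_real_less_iff using h l0 by simp
      finally have "sinh (hyperbolic_dist x y / 2) < sinh (r / 2)"
        unfolding sR using s by simp
      then show "y \<in> hyperbolic_ball x r" using y by (simp add: hyperbolic_ball_def)
    qed
  qed
  have outer: "hyperbolic_ball x r \<subseteq> hilbert_ball x l1 \<longleftrightarrow> r \<le> l1"
  proof
    assume sub: "hyperbolic_ball x r \<subseteq> hilbert_ball x l1"
    show "r \<le> l1"
    proof (rule ccontr)
      assume "\<not> r \<le> l1"
      \<comment> \<open>The maximum provides a positive distance even if \<open>l1\<close> is not positive.\<close>
      with assms(3) have d: "0 < max l1 (r / 2)" "max l1 (r / 2) < r" by auto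
      obtain y where "norm y < 1" "hilbert_dist x y = max l1 (r / 2)"
        "hyperbolic_dist x y = max l1 (r / 2)"
        by (rule dists_agree_on_diameter[OF x d(1)])
      with d(2) sub show False by (auto simp: hyperbolic_ball_def hilbert_ball_def)
    qed
  next
    assume "r \<le> l1"
    then show "hyperbolic_ball x r \<subseteq> hilbert_ball x l1"
      using hilbert_dist_bounds(1)[OF x] by (fastforce simp: hyperbolic_ball_def hilbert_ball_def)
  qed
  have proper: "hilbert_ball x l1 \<subset> ball 0 1"
  proof -
    obtain y where "norm y < 1" "hilbert_dist x y = max l1 1"
      by (rule dists_agree_on_diameter[OF x, of "max l1 1"]) auto
    then have "y \<in> ball 0 1" "y \<notin> hilbert_ball x l1" by (auto simp: hilbert_ball_def)
    then show ?thesis unfolding hilbert_ball_def by blast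
  qed
  show ?thesis using inner outer proper by simp
qed

end
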